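(* If $M$ is a positive integer divisible by $5$, then an $M$-free $1$-partition of $n$ exists for all integers $n\ge 126$. Moreover, a $\{2,3\}$-full $1$-partition of $n$ exists for all integers $n\ge 531$.
   Context: For a positive rational $\alpha$ and a positive integer $n$, an $\alpha$-partition of $n$ is a finite set $\{a_1,\ldots,a_r\}$ of distinct positive integers with $a_1+\cdots+a_r=n$ and $\frac1{a_1}+\cdots+\frac1{a_r}=\alpha$. For an integer $M\ge 2$, an $\alpha$-partition is $M$-free if none of the $a_i$ is divisible by $M$. For a set $P$ of primes, an $\alpha$-partition is $P$-full if all prime factors of all the $a_i$ are contained in $P$ (not every prime of $P$ need occur, and $a_i=1$ is allowed). *)

theory Defs
  imports Complex_Main "HOL-Computational_Algebra.Primes"
begin

definition alpha_partition :: "rat \<Rightarrow> nat \<Rightarrow> nat set \<Rightarrow> bool" where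
  "alpha_partition \<alpha> n A \<longleftrightarrow>
     finite A \<and> (\<forall>a\<in>A. 0 < a) \<and> \<Sum>A = n \<and> (\<Sum>a\<in>A. 1 / of_nat a) = \<alpha>"

definition M_free :: "nat \<Rightarrow> nat set \<Rightarrow> bool" where
  "M_free M A \<longleftrightarrow> (\<forall>a\<in>A. \<not> M dvd a)"

definition P_full :: "nat set \<Rightarrow> nat set \<Rightarrow> bool" where
  "P_full P A \<longleftrightarrow> (\<forall>a\<in>A. prime_factors a \<subseteq> P)"

end

theory Submission
  imports Defs "HOL-Library.Code_Binary_Nat" "HOL-Library.Tree"
begin

text \<open>
  Scaling is the source of new partitions. If \<open>A\<close> is a 1-partition of \<open>m\<close> without the element 1, then
  the multiples \<open>k * a\<close> have sum \<open>k * m\<close> and reciprocal sum \<open>1 / k\<close>. A set \<open>C\<close> whose reciprocals add up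
  to \<open>1 - 1 / k\<close> fills this up to a 1-partition of \<open>\<Sum>C + k * m\<close>. The two parts are disjoint if \<open>C\<close>
  contains no multiple of \<open>k\<close> except possibly \<open>k\<close> itself, and if \<open>k\<close> and the elements of \<open>C\<close> have no
  prime factors besides 2 and 3, then \<open>{2, 3}\<close>-full partitions stay \<open>{2, 3}\<close>-full
  (\<open>smooth_sum_filling\<close>).

  Four pairs \<open>(k, C)\<close> lead from \<open>m\<close> to \<open>2 * m + 2\<close>, \<open>4 * m + 13\<close>, \<open>8 * m + 119\<close> and \<open>8 * m + 363\<close>. These
  are the even numbers and the residue classes 1 modulo 4, 7 modulo 8 and 3 modulo 8, so every large
  \<open>n\<close> arises from a smaller \<open>m\<close>. Such an induction needs a start, and among small numbers there are
  gaps. They are collected in a list \<open>exceptions\<close> with maximum 530, and strong induction shows that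
  every number outside the list has a \<open>{2, 3}\<close>-full 1-partition (\<open>smooth_sum_unless_exception\<close>). An
  exception \<open>m\<close> obstructs the induction only at the four numbers \<open>k * m + \<Sum>C\<close>. Hence finitely many
  numbers remain: these, and the ones below 531. Most of them arise from an unexceptional \<open>m\<close> by
  some further pair \<open>(k, C)\<close>, and the others have a partition in an explicit table
  (\<open>unreached_critical\<close>).

  A number with no prime factors besides 2 and 3 is not divisible by 5, so the result on \<open>M\<close>-free
  partitions follows for every \<open>n\<close> outside \<open>exceptions\<close>. The exceptions from 126 on have 1-partitions
  in which the primes 7 and 11 are used as well; a second table lists them.
\<close>

definition smooth_sum :: "nat \<Rightarrow> bool" where
  "smooth_sum n \<longleftrightarrow> (\<exists>A. alpha_partition 1 n A \<and> P_full {2, 3} A)"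

section \<open>Lists of divisors of a common multiple\<close>

text \<open>
  If all elements divide \<open>N\<close>, the reciprocals can be added as integers \<open>N div x\<close>, and the choice of \<open>N\<close>
  controls the prime factors of the elements. A list is thereby checked by natural number arithmetic.
\<close>

definition divisor_list :: "nat \<Rightarrow> nat list \<Rightarrow> bool" where
  "divisor_list N xs \<longleftrightarrow> distinct xs \<and> (\<forall>x\<in>set xs. x dvd N)"

lemma alpha_partition_divisor_list:
  assumes "0 < N" "divisor_list N xs"
  shows "alpha_partition (of_nat (\<Sum>x\<leftarrow>xs. N div x) / of_nat N) (sum_list xs) (set xs)"
proof -
  from assms have dist: "distinct xs" and dvd: "\<And>x. x \<in> set xs \<Longrightarrow> x dvd N"
    by (auto simp: divisor_list_def)
  have "(\<Sum>a\<in>set xs. 1 / of_nat a) = (\<Sum>a\<in>set xs. of_nat (N div a) / of_nat N :: rat)"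
  proof (rule sum.cong)
    fix a assume "a \<in> set xs"
    then have "a dvd N" by (rule dvd)
    then show "1 / of_nat a = (of_nat (N div a) / of_nat N :: rat)"
      using \<open>0 < N\<close> by (auto elim!: dvdE simp: field_simps)
  qed simp
  also have "\<dots> = of_nat (\<Sum>x\<leftarrow>xs. N div x) / of_nat N"
    using dist by (simp add: sum_divide_distrib sum_list_distinct_conv_sum_set)
  finally show ?thesis
    using dist dvd \<open>0 < N\<close>
    by (auto simp: alpha_partition_def distinct_sum_list_conv_Sum dest: dvd_pos_nat)
qed

definition unit_list :: "nat \<Rightarrow> nat list \<Rightarrow> bool" where
  "unit_list N xs \<longleftrightarrow> divisor_list N xs \<and> (\<Sum>x\<leftarrow>xs. N div x) = N"

lemma alpha_partition_unit_list:
  assumes "0 < N" "unit_list N xs"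
  shows "alpha_partition 1 (sum_list xs) (set xs)"
  using alpha_partition_divisor_list[of N xs] assms by (simp add: unit_list_def)

lemma P_full_divisors:
  assumes "0 < N" "prime_factors N \<subseteq> P" "\<forall>a\<in>A. a dvd N"
  shows "P_full P A"
  unfolding P_full_def
proof
  fix a assume "a \<in> A"
  then have "a dvd N" using assms(3) by blast
  then have "prime_factors a \<subseteq> prime_factors N"
    using \<open>0 < N\<close> by (intro dvd_prime_factors) auto
  then show "prime_factors a \<subseteq> P" using assms(2) by (rule order_trans)
qed

lemma prime_factors_two_three: "prime_factors (2 ^ i * 3 ^ j :: nat) \<subseteq> {2, 3}"
proof
  fix p :: nat assume "p \<in> prime_factors (2 ^ i * 3 ^ j)"
  then have "prime p" "p dvd 2 ^ i * 3 ^ j"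
    by (auto simp: in_prime_factors_iff)
  then have "p dvd 2 \<or> p dvd 3"
    by (metis prime_dvd_mult_iff prime_dvd_power)
  with \<open>prime p\<close> show "p \<in> {2, 3}"
    using primes_dvd_imp_eq[of p 2] primes_dvd_imp_eq[of p 3] by auto
qed

section \<open>Scaling a partition and filling it up\<close>

text \<open>
  The element 1 already exhausts the reciprocal sum, so no other element can accompany it.
\<close>

lemma one_notin_partition:
  assumes "alpha_partition 1 n A" "n \<noteq> 1"
  shows "1 \<notin> A"
proof
  assume "1 \<in> A"
  from assms have fin: "finite A" and pos: "\<forall>a\<in>A. 0 < a"
    and sum: "\<Sum>A = n" and recip: "(\<Sum>a\<in>A. 1 / of_nat a) = (1 :: rat)"
    by (auto simp: alpha_partition_def)
  have "(\<Sum>a\<in>A - {1}. 1 / of_nat a) = (0 :: rat)"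
    using recip fin \<open>1 \<in> A\<close> by (simp add: sum.remove)
  then have zero: "\<forall>a\<in>A - {1}. 1 / of_nat a = (0 :: rat)"
    using fin by (subst (asm) sum_nonneg_eq_0_iff) auto
  have "A - {1} = {}"
  proof (rule equals0I)
    fix a assume a: "a \<in> A - {1}"
    then have "0 < a" "1 / of_nat a = (0 :: rat)" using pos zero by blast+
    then show False by simp
  qed
  with \<open>1 \<in> A\<close> have "A = {1}" by blast
  with sum \<open>n \<noteq> 1\<close> show False by simp
qed

text \<open>
  A common element of \<open>C\<close> and the scaled set would be a multiple \<open>k * a\<close> in \<open>C\<close>, hence \<open>k\<close> itself, which
  forces \<open>a = 1\<close>. So \<open>C\<close> may contain \<open>k\<close> as soon as \<open>A\<close> avoids 1.
\<close>

lemma scaled_partition: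
  assumes A: "alpha_partition 1 m A" "1 \<notin> A"
    and C: "alpha_partition (1 - 1 / of_nat k) s C" "\<forall>c\<in>C. k dvd c \<longrightarrow> c = k"
    and k: "0 < k"
  shows "alpha_partition 1 (s + k * m) (C \<union> (*) k ` A)"
proof -
  have fin: "finite A" "finite C" and pos: "\<forall>a\<in>A. 0 < a" "\<forall>c\<in>C. 0 < c"
    and sums: "\<Sum>A = m" "\<Sum>C = s"
    and recips: "(\<Sum>a\<in>A. 1 / of_nat a) = (1 :: rat)"
      "(\<Sum>c\<in>C. 1 / of_nat c) = (1 - 1 / of_nat k :: rat)"
    using A C by (auto simp: alpha_partition_def)
  have inj: "inj_on ((*) k) A" using k by (auto simp: inj_on_def)
  have disj: "C \<inter> (*) k ` A = {}"
  proof (rule equals0I)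
    fix c assume "c \<in> C \<inter> (*) k ` A"
    then obtain a where a: "k * a \<in> C" "a \<in> A" by blast
    then have "k * a = k" using C(2) by simp
    then have "a = 1" using k by simp
    with a A(2) show False by simp
  qed
  have sum_scaled: "\<Sum>((*) k ` A) = k * m"
    using sums by (simp add: sum.reindex[OF inj] flip: sum_distrib_left[of k "\<lambda>a. a"])
  have recip_scaled: "(\<Sum>a\<in>(*) k ` A. 1 / of_nat a) = (1 / of_nat k :: rat)"
  proof -
    have "(\<Sum>a\<in>(*) k ` A. 1 / of_nat a) = (\<Sum>a\<in>A. 1 / of_nat k * (1 / of_nat a) :: rat)"
      by (simp add: sum.reindex[OF inj])
    also have "\<dots> = 1 / of_nat k"
      unfolding sum_distrib_left[symmetric] recips(1) by simp
    finally show ?thesis .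
  qed
  have "\<Sum>(C \<union> (*) k ` A) = s + k * m"
    using fin disj by (simp add: sum.union_disjoint sums(2) sum_scaled)
  moreover have "(\<Sum>a\<in>C \<union> (*) k ` A. 1 / of_nat a) = (1 :: rat)"
    using fin disj by (simp add: sum.union_disjoint recips(2) recip_scaled)
  moreover have "\<forall>a\<in>C \<union> (*) k ` A. 0 < a"
    using pos k by (simp add: ball_Un)
  ultimately show ?thesis
    using fin by (simp add: alpha_partition_def)
qed

text \<open>
  The pair \<open>(k, C)\<close> satisfies the requirements of \<open>scaled_partition\<close>: the third condition is
  \<open>1 / k + \<Sum> (1 / c) = 1\<close>, multiplied by \<open>N\<close>.
\<close>

definition filling :: "nat \<Rightarrow> nat \<times> nat list \<Rightarrow> bool" where
  "filling N = (\<lambda>(k, C). divisor_list N C \<and> k dvd N \<and>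
     (\<Sum>c\<leftarrow>C. N div c) + N div k = N \<and> (\<forall>c\<in>set C. k dvd c \<longrightarrow> c = k))"

lemma smooth_sum_filling:
  assumes N: "0 < N" "prime_factors N \<subseteq> {2, 3}" and "filling N (k, C)"
    and m: "smooth_sum m" "m \<noteq> 1"
  shows "smooth_sum (sum_list C + k * m)"
proof -
  from m obtain A where A: "alpha_partition 1 m A" "P_full {2, 3} A"
    by (auto simp: smooth_sum_def)
  from assms have C: "divisor_list N C" and "k dvd N"
    and total: "(\<Sum>c\<leftarrow>C. N div c) + N div k = N" and multiples: "\<forall>c\<in>set C. k dvd c \<longrightarrow> c = k"
    by (auto simp: filling_def)
  have "0 < k" using \<open>k dvd N\<close> N by (auto dest: dvd_pos_nat)
  have "of_nat (\<Sum>c\<leftarrow>C. N div c) + of_nat (N div k) = (of_nat N :: rat)"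
    using total by (metis of_nat_add)
  moreover have "of_nat (N div k) = (of_nat N / of_nat k :: rat)"
    using \<open>k dvd N\<close> \<open>0 < k\<close> by (auto elim!: dvdE)
  ultimately have "of_nat (\<Sum>c\<leftarrow>C. N div c) / of_nat N = (1 - 1 / of_nat k :: rat)"
    using N \<open>0 < k\<close> by (simp add: field_simps)
  then have "alpha_partition (1 - 1 / of_nat k) (sum_list C) (set C)"
    using alpha_partition_divisor_list[OF N(1) C] by simp
  then have "alpha_partition 1 (sum_list C + k * m) (set C \<union> (*) k ` A)"
    using A(1) one_notin_partition[OF A(1) m(2)] multiples \<open>0 < k\<close> by (intro scaled_partition) auto
  moreover have "P_full {2, 3} (set C \<union> (*) k ` A)"
  proof -
    have "P_full {2, 3} (set C)" "P_full {2, 3} {k}"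
      using C \<open>k dvd N\<close> N by (auto intro!: P_full_divisors simp: divisor_list_def)
    moreover have "prime_factors (k * a) = prime_factors k \<union> prime_factors a" if "a \<in> A" for a
      using that A(1) \<open>0 < k\<close> by (intro prime_factors_product) (auto simp: alpha_partition_def)
    ultimately show ?thesis
      using A(2) by (simp add: P_full_def ball_Un)
  qed
  ultimately have "alpha_partition 1 (sum_list C + k * m) (set C \<union> (*) k ` A) \<and>
      P_full {2, 3} (set C \<union> (*) k ` A)" ..
  then show ?thesis unfolding smooth_sum_def ..
qed

section \<open>Sums of 1-partitions into 3-smooth numbers\<close>

text \<open>
  With the sums 2, 13, 119 and 363 of their second components, these four pairs lead to even numbers,
  to \<open>1\<close> modulo 4, and to \<open>7\<close> and \<open>3\<close> modulo 8.
\<close>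

definition main_fillings :: "(nat \<times> nat list) list" where
  "main_fillings = [
    (2, [2]),
    (4, [3, 4, 6]),
    (8, [3, 6, 8, 9, 12, 27, 54]),
    (8, [4, 6, 8, 9, 12, 18, 27, 36, 81, 162])]"

text \<open>
  The additional pairs shorten the table of explicit partitions; the induction for large numbers uses
  the main pairs.
\<close>

definition fillings :: "(nat \<times> nat list) list" where
  "fillings = main_fillings @ [
    (6, [2, 3]),
    (8, [3, 4, 8, 12, 18, 54, 108]),
    (8, [3, 4, 8, 9, 36, 81, 108, 162]),
    (4, [3, 4, 9, 27, 54]),
    (12, [3, 4, 6, 9, 27, 54]),
    (4, [3, 4, 9, 18]),
    (8, [3, 4, 8, 12, 18, 36]),
    (16, [2, 6, 12, 16, 18, 27, 54, 72]),
    (16, [2, 6, 9, 16, 18, 24]),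
    (16, [4, 6, 8, 9, 12, 16, 18, 24, 54, 72, 108]),
    (16, [2, 4, 16, 24, 27, 36, 54]),
    (8, [3, 4, 8, 12, 27, 36, 81, 162])]"

text \<open>
  Numbers that may not be scaled, because the induction claims nothing about them. The number 1 belongs to them because its
  partition \<open>{1}\<close> cannot be scaled.
\<close>

definition exceptions :: "nat list" where
  "exceptions = [
    0, 1, 2, 3, 4, 5, 6, 7, 8, 9, 10, 12, 13, 14, 15, 16, 17, 18, 19, 20, 21, 22, 23, 25, 26,
    27, 28, 29, 30, 31, 33, 34, 35, 36, 38, 39, 40, 41, 42, 43, 44, 46, 47, 48, 49, 51, 53, 54,
    55, 56, 58, 59, 60, 61, 62, 63, 64, 65, 68, 69, 70, 72, 73, 74, 75, 77, 79, 80, 82, 83, 84,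
    85, 86, 87, 88, 89, 90, 91, 93, 94, 96, 98, 100, 101, 103, 105, 107, 112, 113, 114, 117,
    118, 119, 120, 122, 124, 125, 126, 127, 128, 131, 132, 133, 135, 138, 139, 140, 142, 145,
    146, 147, 148, 152, 153, 156, 159, 163, 166, 168, 170, 173, 176, 177, 178, 180, 181, 184,
    187, 188, 191, 194, 195, 198, 202, 204, 205, 208, 209, 215, 217, 219, 223, 226, 229, 230,
    233, 236, 237, 238, 239, 240, 243, 246, 250, 252, 254, 257, 261, 263, 264, 268, 271, 278,
    280, 282, 292, 296, 299, 303, 308, 333, 334, 341, 343, 348, 355, 371, 385, 406, 412, 523,
    530]"

text \<open>
  Partitions into divisors of \<open>2 ^ 8 * 3 ^ 5 = 62208\<close>, in the order in which \<open>unreached\<close> finds their sums.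
\<close>

definition smooth_table :: "nat list list" where
  "smooth_table = [
    [2,3,6], [2,3,9,18], [2,3,8,24], [2,4,9,12,18], [3,4,6,9,12,18], [2,6,8,9,18,24],
    [2,3,12,16,48], [2,4,8,9,72], [2,4,9,16,18,48], [3,4,6,8,18,24,36], [3,4,6,9,16,18,48],
    [2,4,9,12,27,54], [2,3,9,24,72], [2,6,9,12,16,18,48], [3,4,6,9,12,27,54], [2,3,8,36,72],
    [2,4,9,12,24,72], [2,4,6,27,36,54], [2,8,9,12,16,18,24,48], [3,4,6,12,16,18,36,48],
    [2,4,9,18,27,36,54], [2,6,8,9,18,36,72], [2,4,8,24,27,36,54], [3,4,6,9,18,27,36,54],
    [2,4,9,16,27,48,54], [2,4,9,18,24,36,72], [3,4,6,9,16,27,48,54], [2,6,8,9,18,32,96],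
    [3,4,8,9,12,16,48,72], [2,6,9,12,16,27,48,54], [2,4,9,16,24,48,72], [2,6,9,12,18,24,36,72],
    [3,4,8,9,18,24,27,36,54], [2,4,9,18,24,32,96], [2,6,9,12,16,24,48,72],
    [2,8,9,12,18,24,27,36,54], [3,4,6,8,16,18,144], [2,3,16,24,36,48,72], [3,4,6,8,18,32,36,96],
    [2,3,18,24,32,36,96], [2,3,9,36,54,108], [2,6,9,16,18,27,36,48,54], [2,4,9,24,27,36,54,72],
    [3,4,6,12,18,24,32,36,96], [2,3,8,54,72,108], [2,3,12,16,72,144], [2,3,12,32,36,72,96],
    [2,4,9,12,36,48,144], [2,3,8,27,216], [3,4,8,9,12,24,36,54,108], [2,4,8,27,32,36,54,96],
    [2,4,9,16,18,72,144], [3,4,6,8,27,32,36,54,96], [3,4,6,8,12,54,72,108], [2,4,8,12,27,216],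
    [3,4,6,9,16,18,72,144], [2,4,6,24,27,216], [2,4,12,16,24,27,54,144], [2,4,6,27,48,54,144],
    [2,6,8,9,18,27,216], [2,4,12,24,27,32,36,54,96], [2,3,12,16,64,192], [2,3,16,18,36,72,144],
    [2,6,9,12,16,32,48,72,96], [3,4,6,12,24,27,32,36,54,96], [3,6,8,9,12,18,27,32,36,54,96],
    [2,4,9,18,27,48,54,144], [2,6,8,9,18,48,72,144], [3,4,6,8,18,36,54,72,108],
    [3,4,6,9,18,27,48,54,144], [2,6,9,12,18,24,27,216], [3,4,9,12,18,24,27,32,36,54,96],
    [2,6,8,9,24,27,81,162], [2,6,9,12,18,27,48,54,144], [2,4,8,16,27,48,216],
    [2,3,12,27,36,81,162], [2,3,16,24,48,54,72,108], [3,4,6,8,16,27,48,216], [2,3,9,27,72,216],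
    [2,3,16,18,36,64,192], [2,6,8,12,16,27,48,216], [2,4,9,12,27,72,216], [2,3,12,24,48,64,192],
    [3,4,6,9,12,27,72,216], [2,6,8,9,32,36,54,96,108], [2,6,9,12,16,32,36,96,144],
    [3,4,6,8,9,108,216], [3,4,6,9,16,27,48,81,162], [3,4,8,12,16,18,24,32,96,144],
    [3,4,6,8,18,32,48,96,144], [2,3,9,24,108,216], [2,4,6,27,36,72,216], [2,6,8,9,24,27,72,216],
    [2,3,18,24,32,48,96,144], [2,6,8,9,16,64,72,192], [2,6,8,9,27,48,54,72,144],
    [2,3,8,36,108,216], [3,4,6,16,18,27,32,48,54,72,96], [3,4,8,12,18,24,27,36,48,54,144],
    [2,3,12,32,54,72,96,108], [2,4,9,18,27,36,72,216], [2,3,18,24,36,48,64,192],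
    [2,6,9,12,16,24,32,288], [2,3,9,48,64,72,192], [3,4,8,9,12,32,36,48,96,144],
    [2,4,9,12,32,48,288], [2,6,9,12,16,24,64,72,192], [2,6,9,12,18,27,36,72,216],
    [2,4,9,12,48,64,72,192], [2,6,9,16,18,27,36,48,81,162], [3,4,6,9,12,48,64,72,192],
    [3,4,6,9,18,27,32,96,216], [2,6,8,9,16,48,108,216], [2,6,8,9,24,32,48,288],
    [2,6,9,12,18,27,32,96,216], [2,6,9,16,18,24,32,72,96,144], [2,3,16,27,36,48,72,216],
    [2,6,8,9,27,32,81,96,162], [2,6,8,9,24,48,64,72,192], [2,4,9,16,24,48,108,216],
    [3,4,6,9,18,32,48,72,96,144], [2,3,8,36,96,288], [2,4,9,12,24,96,288], [2,3,8,72,81,108,162],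
    [2,4,12,16,18,27,144,216], [2,3,16,27,32,48,96,216], [2,4,12,18,27,32,36,96,216],
    [3,4,8,9,12,24,36,81,108,162], [2,4,8,27,32,36,81,96,162], [2,4,9,16,27,36,144,216],
    [3,4,6,8,27,32,36,81,96,162], [3,4,6,12,16,27,32,48,96,216], [3,4,8,12,16,18,27,32,54,288],
    [2,4,8,18,27,48,144,216], [2,6,8,9,27,32,72,96,216], [2,8,12,16,18,24,27,32,36,54,96,144],
    [3,4,6,12,18,32,36,48,72,96,144], [2,6,8,16,24,27,32,48,96,216],
    [2,4,12,24,27,32,36,81,96,162], [2,3,18,27,48,54,64,72,192], [2,3,18,24,27,48,144,216],
    [2,3,16,18,48,72,108,216], [2,4,9,27,32,48,54,72,96,144], [2,4,8,16,27,72,144,216],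
    [2,4,9,18,27,48,81,144,162], [2,3,12,16,108,144,216], [3,4,6,9,18,27,48,81,144,162],
    [2,3,9,36,72,96,288], [2,6,9,12,18,27,48,81,144,162], [2,4,9,24,27,36,48,144,216],
    [2,6,8,12,18,27,54,96,288], [2,4,9,24,32,36,48,72,288], [2,3,16,24,48,72,81,108,162],
    [2,4,9,16,18,108,144,216], [2,3,12,27,48,72,144,216], [2,3,16,24,32,54,108,288],
    [3,4,6,9,18,24,32,144,288], [3,4,6,9,16,32,48,96,108,216], [2,3,16,24,27,64,192,216],
    [2,4,16,18,27,32,48,72,81,96,162], [3,6,8,9,12,16,24,36,48,64,144,192],
    [2,3,18,27,36,48,72,144,216], [2,3,18,27,32,48,96,144,216], [2,4,9,16,27,32,216,288],
    [3,4,8,9,12,18,54,96,108,288], [3,4,6,9,18,24,32,128,384], [2,3,24,27,36,54,64,72,144,192],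
    [3,4,6,8,27,32,36,48,216,288], [2,6,8,9,24,27,108,162,324], [2,3,16,24,27,72,108,432],
    [3,4,8,9,16,24,32,48,64,192,288], [3,4,8,9,12,32,36,54,108,144,288],
    [3,4,8,12,16,24,27,36,54,96,144,288], [2,3,12,48,64,72,81,108,162,192],
    [3,4,8,9,16,24,32,36,64,576], [2,3,16,27,54,64,72,96,192,288],
    [2,4,12,16,27,36,54,81,162,432], [2,3,9,54,72,108,128,288,384], [2,3,9,48,64,72,288,576],
    [2,4,8,24,27,48,72,144,216], [2,4,12,18,27,36,54,64,144,192], [2,3,16,24,48,64,72,144,192],
    [2,3,24,32,36,48,64,72,96,192], [2,4,9,18,24,48,108,144,216],
    [2,6,9,16,18,27,32,81,96,144,162], [2,3,18,36,48,54,64,72,108,192], [2,4,9,18,24,32,128,384],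
    [2,6,9,12,18,24,48,54,432], [2,6,8,9,16,64,108,192,216], [2,3,8,54,72,162,324],
    [2,3,16,24,32,48,128,384], [2,6,8,9,24,48,64,108,192,216], [2,4,9,18,32,36,72,128,384],
    [2,6,8,9,16,72,96,128,384], [2,3,16,24,36,72,96,128,384], [3,4,6,8,18,36,54,72,144,432],
    [2,3,18,24,32,54,96,144,432], [2,4,9,12,32,54,288,432], [2,6,8,9,16,36,192,576],
    [2,3,8,36,128,288,384], [2,4,9,16,18,72,192,576], [2,4,8,12,54,81,108,648],
    [3,4,6,9,18,32,36,81,96,648], [2,3,12,32,36,96,144,216,432], [2,3,16,24,32,72,96,192,576],
    [3,4,6,9,12,32,81,162,288,432], [2,6,8,9,16,64,72,288,576], [2,3,9,27,128,216,288,384],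
    [2,4,9,16,18,108,192,216,576], [2,3,16,18,48,72,96,288], [3,4,8,9,12,32,36,81,96,108,162],
    [2,3,8,54,96,108,288], [2,3,16,27,36,64,81,162,192], [2,4,9,16,32,48,72,144,288],
    [3,4,6,8,16,36,54,72,432], [2,3,16,24,36,54,72,432], [2,3,12,32,48,54,96,432],
    [2,3,16,18,32,64,576], [2,3,8,36,162,216,324], [3,4,6,8,9,81,648], [2,3,12,24,54,64,192,432],
    [2,4,8,12,36,81,648], [2,3,18,24,48,64,72,96,192,288], [2,4,8,9,128,288,384],
    [3,4,6,9,16,24,48,81,648], [2,3,12,32,54,72,96,144,432], [2,3,9,32,81,96,648],
    [2,3,12,32,54,64,96,192,432], [2,6,9,12,16,18,72,192,576], [2,4,8,27,32,48,54,96,216,432],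
    [2,4,8,18,36,54,81,108,648], [2,3,8,54,108,128,288,384], [3,4,6,9,18,24,27,324,648],
    [2,4,9,18,32,48,54,128,384,432], [2,4,6,18,81,96,288,648], [2,3,16,18,36,108,192,216,576],
    [2,4,9,16,24,48,108,324,648], [2,4,6,27,48,64,216,288,576], [2,3,8,72,108,144,162,324,432],
    [2,3,9,32,81,128,384,648], [2,3,12,16,96,162,324,864], [2,3,8,54,96,108,432,864],
    [2,3,8,48,72,162,1296], [2,3,12,24,54,64,256,432,768], [2,4,9,16,24,32,384,1152],
    [2,3,16,18,24,288,432,864], [2,3,16,24,36,54,64,1728], [2,4,9,18,27,36,81,324,486,972],
    [2,3,18,24,32,54,96,162,432,1296], [2,4,6,18,81,96,432,648,864], [2,3,16,18,24,216,648,1296],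
    [2,3,8,36,108,486,648,972], [2,4,9,16,32,48,96,108,216], [2,4,8,12,54,81,162,216],
    [2,4,9,12,32,72,144,288], [2,4,9,16,36,48,72,96,288], [3,4,6,8,12,54,96,108,288],
    [2,4,8,27,32,36,54,144,288], [2,3,16,32,36,54,72,108,288], [2,3,18,24,32,36,128,384],
    [2,3,9,27,108,162,324], [3,4,6,8,16,32,54,96,432], [2,3,16,18,36,96,128,384],
    [2,3,16,18,64,72,108,192,216], [2,4,6,27,48,72,108,432], [2,4,9,16,32,36,64,576],
    [3,4,6,9,18,27,32,144,216,288], [2,4,8,18,36,81,96,108,162,288], [2,3,16,24,48,54,64,192,432],
    [2,4,9,16,24,36,192,576], [2,3,16,18,36,72,192,576], [2,3,16,18,36,64,288,576],
    [2,3,8,54,96,144,288,432], [2,4,6,32,36,81,162,288,432], [2,4,8,18,27,48,96,864],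
    [2,4,6,18,81,108,216,648], [2,6,8,12,16,27,48,324,648], [2,3,8,54,96,128,384,432],
    [2,3,9,24,216,243,324,486], [2,4,6,27,48,64,192,324,648], [2,4,9,16,24,48,108,288,864],
    [2,3,16,18,48,72,108,288,864], [2,3,8,54,64,288,432,576], [2,3,8,48,162,192,216,324,576],
    [2,3,8,54,64,256,432,768], [2,3,8,36,162,192,576,1296]]"

text \<open>
  The numerous lookups among the exceptions use a search tree, balanced by cutting the ascending list
  in the middle; depth 8 holds up to 255 entries. A positive answer of \<open>occurs\<close> implies membership for
  every list (\<open>occurs_imp_mem\<close>), so soundness does not rest on the order.
\<close>

fun search_tree :: "nat \<Rightarrow> nat list \<Rightarrow> nat tree" where
  "search_tree 0 xs = Leaf"
| "search_tree (Suc d) xs =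
    (case drop (length xs div 2) xs of
       [] \<Rightarrow> Leaf
     | x # ys \<Rightarrow> Node (search_tree d (take (length xs div 2) xs)) x (search_tree d ys))"

fun occurs :: "nat \<Rightarrow> nat tree \<Rightarrow> bool" where
  "occurs n Leaf = False"
| "occurs n (Node l x r) = (if n < x then occurs n l else if n = x then True else occurs n r)"

text \<open>
  The entry \<open>(k, s)\<close> stands for the map \<open>m \<mapsto> s + k * m\<close>, which is inverted at \<open>n\<close>. Nested conditionals replace
  boolean connectives, since rewriting would evaluate both arguments of a connective.
\<close>

fun reached :: "nat tree \<Rightarrow> (nat \<times> nat) list \<Rightarrow> nat \<Rightarrow> bool" where
  "reached t [] n = False"
| "reached t ((k, s) # fs) n =
    (if n < s then reached t fs n
     else if (n - s) mod k \<noteq> 0 then reached t fs n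
     else if occurs ((n - s) div k) t then reached t fs n
     else True)"

fun unreached :: "nat tree \<Rightarrow> (nat \<times> nat) list \<Rightarrow> nat list \<Rightarrow> nat list" where
  "unreached t fs [] = []"
| "unreached t fs (n # ns) =
    (if occurs n t then unreached t fs ns
     else if reached t fs n then unreached t fs ns
     else n # unreached t fs ns)"

definition shifts :: "(nat \<times> nat list) list \<Rightarrow> (nat \<times> nat) list" where
  "shifts = map (\<lambda>(k, C). (k, sum_list C))"

abbreviation exception :: "nat \<Rightarrow> bool" where
  "exception n \<equiv> occurs n (search_tree 8 exceptions)"

text \<open>
  The numbers that the main pairs do not settle: those below 531, and those that a main pair produces
  from an exception.
\<close>

definition critical :: "nat list" where
  "critical = [0..<531] @
     concat (map (\<lambda>(k, s). filter (\<lambda>n. 531 \<le> n) (map (\<lambda>b. k * b + s) exceptions))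
       (shifts main_fillings))"

lemma fillings_valid: "list_all (filling 62208) fillings"
  by code_simp

lemma smooth_table_valid: "list_all (unit_list 62208) smooth_table"
  by code_simp

text \<open>
  This is where the finite search is carried out: a critical number outside \<open>exceptions\<close> comes from an
  unexceptional number by some pair in \<open>fillings\<close>, or it is the sum of a list in \<open>smooth_table\<close>.
\<close>

lemma unreached_critical:
  "unreached (search_tree 8 exceptions) (shifts fillings) critical = map sum_list smooth_table"
  by code_simp

lemma occurs_imp_mem: "occurs n (search_tree d xs) \<Longrightarrow> n \<in> set xs"
proof (induction d arbitrary: xs)
  case (Suc d)
  show ?case
  proof (cases "drop (length xs div 2) xs")
    case Nil
    with Suc.prems show ?thesis by (simp del: drop_eq_Nil)
  next
    case (Cons x ys)
    then have "set (take (length xs div 2) xs) \<subseteq> set xs" "insert x (set ys) \<subseteq> set xs"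
      by (metis set_take_subset, metis list.set(2) set_drop_subset)
    with Suc Cons show ?thesis by (auto split: if_splits)
  qed
qed simp

lemma reachedE:
  assumes "reached t (shifts fs) n"
  obtains k C m where "(k, C) \<in> set fs" "n = sum_list C + k * m" "\<not> occurs m t"
proof -
  have "\<exists>k C m. (k, C) \<in> set fs \<and> n = sum_list C + k * m \<and> \<not> occurs m t"
    using assms
  proof (induction fs)
    case (Cons f fs)
    obtain k C where f: "f = (k, C)" by fastforce
    show ?case
    proof (cases "sum_list C \<le> n \<and> (n - sum_list C) mod k = 0 \<and>
        \<not> occurs ((n - sum_list C) div k) t")
      case True
      then have "n = sum_list C + k * ((n - sum_list C) div k)"
        by (metis add.right_neutral le_add_diff_inverse mult_div_mod_eq)
      with True f show ?thesis by (metis list.set_intros(1))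
    next
      case False
      with Cons.prems have "reached t (shifts fs) n"
        by (auto simp: shifts_def f split: if_splits)
      from Cons.IH[OF this] show ?thesis by auto
    qed
  qed (simp add: shifts_def)
  then show ?thesis using that by blast
qed

lemma mem_unreached:
  "n \<in> set ns \<Longrightarrow> occurs n t \<or> reached t fs n \<or> n \<in> set (unreached t fs ns)"
  by (induction ns) auto

lemma fillings_increase: "(k, C) \<in> set fillings \<Longrightarrow> m < sum_list C + k * m"
  by (auto simp: fillings_def main_fillings_def)

lemma one_exception: "exception 1"
  by code_simp

lemma exceptions_less: "b \<in> set exceptions \<Longrightarrow> b < 531"
  by (auto simp: exceptions_def)

text \<open>
  The maps cover the even residues modulo 8, then 1 and 5, then 7, then 3. Writing
  \<open>n = 8 * (66 + q) + n mod 8\<close>, where \<open>531 = 8 * 66 + 3\<close>, keeps the witnesses free of truncated subtraction.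
\<close>

lemma large_number_cases:
  fixes n :: nat
  assumes "531 \<le> n"
  shows "\<exists>m. n = 2 + 2 * m \<or> n = 13 + 4 * m \<or> n = 119 + 8 * m \<or> n = 363 + 8 * m"
proof -
  define q r where "q = n div 8 - 66" and "r = n mod 8"
  have "66 \<le> n div 8" using assms by simp
  then have n: "n = 8 * (66 + q) + r" and "r < 8" by (simp_all add: q_def r_def)
  from \<open>r < 8\<close> have "r = 0 \<or> r = 1 \<or> r = 2 \<or> r = 3 \<or> r = 4 \<or> r = 5 \<or> r = 6 \<or> r = 7"
    by linarith
  then have "n = 2 + 2 * (4 * q + 263) \<or> n = 13 + 4 * (2 * q + 129) \<or> n = 2 + 2 * (4 * q + 264) \<or>
      n = 363 + 8 * (q + 21) \<or> n = 2 + 2 * (4 * q + 265) \<or> n = 13 + 4 * (2 * q + 130) \<or>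
      n = 2 + 2 * (4 * q + 266) \<or> n = 119 + 8 * (q + 52)"
    using n by (elim disjE) simp_all
  then show ?thesis by metis
qed

lemma main_fillingE:
  assumes "531 \<le> n"
  obtains k C m where "(k, C) \<in> set main_fillings" "n = sum_list C + k * m"
proof -
  have "\<exists>m. n = 2 + 2 * m \<or> n = 13 + 4 * m \<or> n = 119 + 8 * m \<or> n = 363 + 8 * m"
    using assms by (rule large_number_cases)
  then have "\<exists>(k, C)\<in>set main_fillings. \<exists>m. n = sum_list C + k * m"
    by (auto simp: main_fillings_def)
  then show ?thesis using that by blast
qed

text \<open>
  A critical number is covered by the finite search. Any other number is at least 531 and therefore
  arises from some \<open>m\<close> by a main pair; were \<open>m\<close> an exception, the number would be critical.
\<close>

lemma smooth_sum_unless_exception: "\<not> exception n \<Longrightarrow> smooth_sum n"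
proof (induction n rule: less_induct)
  case (less n)
  have prime_factors_N: "prime_factors 62208 \<subseteq> {2, 3 :: nat}"
    using prime_factors_two_three[of 8 5] by simp
  have fill: "smooth_sum n"
    if "(k, C) \<in> set fillings" "n = sum_list C + k * m" "\<not> exception m" for k C m
  proof -
    have "m < n" using that fillings_increase by simp
    with that(3) have "smooth_sum m" by (intro less.IH)
    moreover have "m \<noteq> 1" using that(3) one_exception by metis
    moreover have "filling 62208 (k, C)"
      using fillings_valid that(1) by (auto simp: list_all_iff)
    ultimately show ?thesis
      using smooth_sum_filling[OF _ prime_factors_N] that(2) by simp
  qed
  show ?case
  proof (cases "n \<in> set critical")
    case True
    then consider "reached (search_tree 8 exceptions) (shifts fillings) n"
      | "n \<in> sum_list ` set smooth_table"
      using mem_unreached[of n critical "search_tree 8 exceptions" "shifts fillings"] less.prems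
      by (auto simp: unreached_critical)
    then show ?thesis
    proof cases
      case 1
      then show ?thesis using fill by (elim reachedE)
    next
      case 2
      then obtain xs where xs: "unit_list 62208 xs" "n = sum_list xs"
        using smooth_table_valid by (auto simp: list_all_iff)
      have "P_full {2, 3} (set xs)"
        using xs(1) prime_factors_N
        by (intro P_full_divisors[of 62208]) (auto simp: unit_list_def divisor_list_def)
      then show ?thesis
        using alpha_partition_unit_list[OF _ xs(1)] xs(2) by (auto simp: smooth_sum_def)
    qed
  next
    case False
    then have "531 \<le> n" by (auto simp: critical_def)
    then obtain k C m where kC: "(k, C) \<in> set main_fillings" "n = sum_list C + k * m"
      by (rule main_fillingE)
    have "(k, C) \<in> set fillings" using kC(1) by (simp add: fillings_def)
    moreover have "\<not> exception m"
    proof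
      assume "exception m"
      then have "m \<in> set exceptions" by (rule occurs_imp_mem)
      then have "n \<in> set critical"
        using kC \<open>531 \<le> n\<close> by (force simp: critical_def shifts_def)
      with False show False by simp
    qed
    ultimately show ?thesis using kC(2) by (intro fill)
  qed
qed

section \<open>Sums of 1-partitions without multiples of 5\<close>

text \<open>
  Partitions into divisors of \<open>2 ^ 6 * 3 ^ 2 * 7 * 11 = 44352\<close>, one for each exception from 126 on.
\<close>

definition five_free_table :: "nat list list" where
  "five_free_table = [
    [3,4,6,7,16,42,48], [2,3,14,24,28,56], [2,6,7,12,21,24,56], [2,4,9,14,18,84],
    [3,4,7,9,18,21,28,42], [2,6,7,12,16,42,48], [2,6,11,12,21,22,28,33], [3,4,6,9,14,18,84],
    [2,3,12,24,42,56], [2,7,8,9,14,28,72], [3,4,7,8,18,24,36,42], [3,4,7,8,9,42,72],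
    [2,6,8,9,21,28,72], [3,6,7,8,9,14,28,72], [2,6,9,16,18,21,28,48], [2,3,14,21,28,84],
    [2,4,7,14,42,84], [3,6,7,8,12,18,24,36,42], [2,4,6,21,42,84], [3,4,7,8,16,21,48,56],
    [2,4,8,18,36,42,56], [3,4,6,8,21,28,42,56], [2,4,12,14,18,36,84], [2,6,7,8,36,42,72],
    [2,4,8,16,42,48,56], [3,4,6,12,14,18,36,84], [2,6,7,14,16,21,112], [2,4,9,18,21,42,84],
    [2,3,18,24,36,42,56], [2,3,9,42,56,72], [2,4,7,24,36,42,72], [2,7,9,12,14,18,42,84],
    [2,6,7,8,28,56,84], [3,4,6,7,24,36,42,72], [2,6,8,9,14,72,84], [2,4,7,21,36,56,72],
    [2,4,12,14,16,42,112], [3,4,7,8,12,32,42,96], [2,4,7,24,28,56,84], [3,4,9,12,14,16,18,48,84],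
    [2,3,8,28,168], [3,4,7,9,18,24,36,42,72], [2,4,8,14,21,168], [2,6,8,9,24,42,56,72],
    [2,3,12,36,42,56,72], [2,4,8,16,28,56,112], [2,3,12,16,84,112], [2,4,8,14,42,48,112],
    [3,4,6,8,16,28,56,112], [2,3,7,56,168], [2,3,12,24,28,168], [2,4,6,32,42,56,96],
    [2,6,8,9,18,28,168], [2,4,8,14,32,84,96], [2,3,12,32,42,56,96], [3,4,7,8,18,32,36,42,96],
    [2,4,8,16,24,84,112], [3,4,6,9,16,18,84,112], [2,6,8,12,14,32,84,96], [2,3,8,48,84,112],
    [2,6,7,8,28,42,168], [2,7,8,12,16,32,42,48,96], [2,4,8,18,28,36,168], [2,4,12,14,24,32,84,96],
    [2,6,7,8,24,56,168], [2,6,8,12,18,28,36,168], [2,4,6,24,48,84,112], [2,3,9,28,72,168],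
    [2,7,8,9,18,24,56,168], [2,6,7,8,21,84,168], [2,4,7,28,42,48,56,112], [2,4,9,14,42,48,72,112],
    [2,4,8,14,28,84,168], [3,4,6,12,14,18,48,84,144], [3,4,6,7,16,42,64,192],
    [2,4,6,21,56,84,168], [2,4,7,24,42,48,72,144], [2,4,12,14,16,72,84,144],
    [2,3,14,24,32,56,224], [2,4,8,16,21,96,224], [2,3,12,28,32,84,224], [2,3,12,21,48,96,224],
    [2,4,8,14,48,56,112,168], [2,4,6,21,42,112,336], [2,3,9,32,84,112,288]]"

lemma five_free_table_valid: "list_all (unit_list 44352) five_free_table"
  by code_simp

lemma sums_five_free_table: "map sum_list five_free_table = filter (\<lambda>b. 126 \<le> b) exceptions"
  by code_simp

lemma five_free_partition:
  assumes "126 \<le> n"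
  shows "\<exists>A. alpha_partition 1 n A \<and> (\<forall>a\<in>A. \<not> 5 dvd a)"
proof (cases "exception n")
  case True
  then have "n \<in> set (map sum_list five_free_table)"
    using assms occurs_imp_mem by (simp add: sums_five_free_table)
  then obtain xs where xs: "unit_list 44352 xs" "n = sum_list xs"
    using five_free_table_valid by (auto simp: list_all_iff)
  \<comment> \<open>The common multiple is prime to 5, hence so are its divisors.\<close>
  have "\<not> 5 dvd a" if "a \<in> set xs" for a
  proof
    assume "5 dvd a"
    moreover have "a dvd 44352" using that xs(1) by (auto simp: unit_list_def divisor_list_def)
    ultimately have "5 dvd (44352 :: nat)" by (rule dvd_trans)
    then show False by simp
  qed
  then show ?thesis
    using alpha_partition_unit_list[OF _ xs(1)] xs(2) by auto
next
  case False
  then obtain A where A: "alpha_partition 1 n A" "P_full {2, 3} A"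
    using smooth_sum_unless_exception by (auto simp: smooth_sum_def)
  have "\<not> 5 dvd a" if "a \<in> A" for a
  proof
    assume "5 dvd a"
    moreover have "0 < a" using A(1) that by (auto simp: alpha_partition_def)
    moreover have "prime (5 :: nat)" by simp
    ultimately have "5 \<in> prime_factors a" by (auto simp: in_prime_factors_iff)
    moreover have "prime_factors a \<subseteq> {2, 3}" using A(2) that unfolding P_full_def by blast
    ultimately have "(5 :: nat) \<in> {2, 3}" by blast
    then show False by simp
  qed
  with A(1) show ?thesis by blast
qed

theorem proposition1:
  shows "(\<forall>M::nat. 0 < M \<and> 5 dvd M \<longrightarrow>
            (\<forall>n::nat. 126 \<le> n \<longrightarrow> (\<exists>A. alpha_partition 1 n A \<and> M_free M A)))
         \<and> (\<forall>n::nat. 531 \<le> n \<longrightarrow> (\<exists>A. alpha_partition 1 n A \<and> P_full {2, 3} A))"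
proof (intro conjI allI impI)
  fix M n :: nat
  assume "0 < M \<and> 5 dvd M" "126 \<le> n"
  then show "\<exists>A. alpha_partition 1 n A \<and> M_free M A"
    using five_free_partition[of n] unfolding M_free_def by (meson dvd_trans)
next
  fix n :: nat
  assume "531 \<le> n"
  then have "\<not> exception n"
    using occurs_imp_mem exceptions_less by fastforce
  then show "\<exists>A. alpha_partition 1 n A \<and> P_full {2, 3} A"
    using smooth_sum_unless_exception by (simp add: smooth_sum_def)
qed

end
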